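(* In the propositional proof system IRL defined in the context, disjunctive syllogism is derivable: for all formulas $\phi,\psi$, $$\{\phi\vee\psi,\ \neg\phi\}\vdash\psi.$$
   Context: Language: formulas are built from a countable set $K$ of primitive propositions using the connectives $\top,\bot$ (nullary), $\neg$ (unary), $\wedge,\vee,\leftrightarrow,\to$ (binary, all syntactically independent symbols). $\neg$ binds strongest, and $\wedge,\vee$ bind more strongly than $\to,\leftrightarrow$. Schematic letters $\phi,\psi,\chi$ range over all formulas. Axiom schemas of IRL: $\phi\leftrightarrow\phi$; $\phi\wedge\psi\leftrightarrow\psi\wedge\phi$; $\phi\vee\psi\leftrightarrow\psi\vee\phi$; $(\phi\wedge\psi)\wedge\chi\leftrightarrow\phi\wedge(\psi\wedge\chi)$; $(\phi\vee\psi)\vee\chi\leftrightarrow\phi\vee(\psi\vee\chi)$; $\phi\wedge(\psi\vee\chi)\leftrightarrow(\phi\wedge\psi)\vee(\phi\wedge\chi)$; $\phi\vee(\psi\wedge\chi)\leftrightarrow(\phi\vee\psi)\wedge(\phi\vee\chi)$; $\phi\wedge\top\leftrightarrow\phi$; $\phi\vee\bot\leftrightarrow\phi$; $\phi\wedge\neg\phi\leftrightarrow\bot$; $\phi\vee\neg\phi\leftrightarrow\top$; $(\phi\to\psi)\leftrightarrow(\phi\wedge\psi\leftrightarrow\phi)$. Primitive rules of IRL: (R1) from $\phi,\psi$ infer $\phi\wedge\psi$; (R2) from $\phi\wedge\psi$ infer $\phi$; (R3) from $\phi\leftrightarrow\psi$ and $\chi$ infer $\chi[\phi\mapsto\psi]$,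 where $\chi[\phi\mapsto\psi]$ is any formula obtained from $\chi$ by replacing one or more arbitrarily selected occurrences of the subformula $\phi$ by $\psi$; (R4, conditional proof) if $\{\phi\}\vdash\psi$ then $\vdash\phi\to\psi$. Derivations: for a finite set $X$ of formulas, $X\vdash y$ means there is a finite sequence of formulas ending in $y$, each member of which is a theorem or results from members of $X$ and earlier members of the sequence by R1, R2 or R3. A theorem is a formula $y$ with $\emptyset\vdash y$ (written $\vdash y$); axioms are theorems, and formulas $\phi\to\psi$ obtained by R4 are theorems. R4 applies only to derivations with the single premise $\phi$ and no other undischarged premises. A rule $X\Rightarrow y$ is derivable if $X\vdash y$. *)

theory Defs
  imports Main "HOL-Library.Countable"
begin

datatype (atoms: 'k) fm =
    Atom 'k
  | Top  ("\<^bold>\<top>")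
  | Bot  ("\<^bold>\<bottom>")
  | Neg "'k fm"  ("\<^bold>\<not> _" [80] 80)
  | Con "'k fm" "'k fm"  (infix "\<^bold>\<and>" 70)
  | Dis "'k fm" "'k fm"  (infix "\<^bold>\<or>" 70)
  | Iff "'k fm" "'k fm"  (infix "\<^bold>\<leftrightarrow>" 60)
  | Imp "'k fm" "'k fm"  (infix "\<^bold>\<rightarrow>" 60)

inductive irl_axiom :: "'k fm \<Rightarrow> bool" where
  iff_refl: "irl_axiom (\<phi> \<^bold>\<leftrightarrow> \<phi>)"
| con_comm: "irl_axiom (\<phi> \<^bold>\<and> \<psi> \<^bold>\<leftrightarrow> \<psi> \<^bold>\<and> \<phi>)"
| dis_comm: "irl_axiom (\<phi> \<^bold>\<or> \<psi> \<^bold>\<leftrightarrow> \<psi> \<^bold>\<or> \<phi>)"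
| con_assoc: "irl_axiom ((\<phi> \<^bold>\<and> \<psi>) \<^bold>\<and> \<chi> \<^bold>\<leftrightarrow> \<phi> \<^bold>\<and> (\<psi> \<^bold>\<and> \<chi>))"
| dis_assoc: "irl_axiom ((\<phi> \<^bold>\<or> \<psi>) \<^bold>\<or> \<chi> \<^bold>\<leftrightarrow> \<phi> \<^bold>\<or> (\<psi> \<^bold>\<or> \<chi>))"
| con_dis_distrib: "irl_axiom (\<phi> \<^bold>\<and> (\<psi> \<^bold>\<or> \<chi>) \<^bold>\<leftrightarrow> (\<phi> \<^bold>\<and> \<psi>) \<^bold>\<or> (\<phi> \<^bold>\<and> \<chi>))"
| dis_con_distrib: "irl_axiom (\<phi> \<^bold>\<or> (\<psi> \<^bold>\<and> \<chi>) \<^bold>\<leftrightarrow> (\<phi> \<^bold>\<or> \<psi>) \<^bold>\<and> (\<phi> \<^bold>\<or> \<chi>))"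
| con_top: "irl_axiom (\<phi> \<^bold>\<and> \<^bold>\<top> \<^bold>\<leftrightarrow> \<phi>)"
| dis_bot: "irl_axiom (\<phi> \<^bold>\<or> \<^bold>\<bottom> \<^bold>\<leftrightarrow> \<phi>)"
| con_neg: "irl_axiom (\<phi> \<^bold>\<and> \<^bold>\<not> \<phi> \<^bold>\<leftrightarrow> \<^bold>\<bottom>)"
| dis_neg: "irl_axiom (\<phi> \<^bold>\<or> \<^bold>\<not> \<phi> \<^bold>\<leftrightarrow> \<^bold>\<top>)"
| imp_iff: "irl_axiom ((\<phi> \<^bold>\<rightarrow> \<psi>) \<^bold>\<leftrightarrow> (\<phi> \<^bold>\<and> \<psi> \<^bold>\<leftrightarrow> \<phi>))"

text \<open>A selection of occurrences of a subformula is encoded as a template: a formula over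
  the atoms extended by a hole \<open>None\<close>, which marks the selected occurrences.\<close>

primrec fill :: "'k fm \<Rightarrow> 'k option fm \<Rightarrow> 'k fm" where
  "fill \<phi> (Atom x) = (case x of None \<Rightarrow> \<phi> | Some p \<Rightarrow> Atom p)"
| "fill \<phi> \<^bold>\<top> = \<^bold>\<top>"
| "fill \<phi> \<^bold>\<bottom> = \<^bold>\<bottom>"
| "fill \<phi> (\<^bold>\<not> a) = \<^bold>\<not> (fill \<phi> a)"
| "fill \<phi> (a \<^bold>\<and> b) = fill \<phi> a \<^bold>\<and> fill \<phi> b"
| "fill \<phi> (a \<^bold>\<or> b) = fill \<phi> a \<^bold>\<or> fill \<phi> b"
| "fill \<phi> (a \<^bold>\<leftrightarrow> b) = (fill \<phi> a \<^bold>\<leftrightarrow> fill \<phi> b)"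
| "fill \<phi> (a \<^bold>\<rightarrow> b) = (fill \<phi> a \<^bold>\<rightarrow> fill \<phi> b)"

text \<open>\<open>None \<in> atoms C\<close> says that at least one occurrence is replaced.\<close>

definition replacement :: "'k fm \<Rightarrow> 'k fm \<Rightarrow> 'k fm \<Rightarrow> 'k fm \<Rightarrow> bool" where
  "replacement \<phi> \<psi> \<chi> \<chi>' \<longleftrightarrow> (\<exists>C. None \<in> atoms C \<and> \<chi> = fill \<phi> C \<and> \<chi>' = fill \<psi> C)"

inductive infers :: "'k fm set \<Rightarrow> 'k fm \<Rightarrow> bool" for P where
  R1: "\<phi> \<in> P \<Longrightarrow> \<psi> \<in> P \<Longrightarrow> infers P (\<phi> \<^bold>\<and> \<psi>)"
| R2: "\<phi> \<^bold>\<and> \<psi> \<in> P \<Longrightarrow> infers P \<phi>"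
| R3: "(\<phi> \<^bold>\<leftrightarrow> \<psi>) \<in> P \<Longrightarrow> \<chi> \<in> P \<Longrightarrow> replacement \<phi> \<psi> \<chi> \<chi>' \<Longrightarrow> infers P \<chi>'"

text \<open>\<open>derivation T X ys y\<close>: the sequence \<open>ys\<close> derives \<open>y\<close> from \<open>X\<close>, where \<open>T\<close> is the class of
  formulas that may be used as theorems. A premise need not be admitted as a line of its own,
  since R1 followed by R2 yields it.\<close>

definition derivation ::
  "('k fm \<Rightarrow> bool) \<Rightarrow> 'k fm set \<Rightarrow> 'k fm list \<Rightarrow> 'k fm \<Rightarrow> bool" where
  "derivation T X ys y \<longleftrightarrow> ys \<noteq> [] \<and> last ys = y \<and>
     (\<forall>i<length ys. T (ys ! i) \<or> infers (X \<union> set (take i ys)) (ys ! i))"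

lemma derivation_mono [mono]:
  "T \<le> T' \<Longrightarrow> derivation T X ys y \<longrightarrow> derivation T' X ys y"
  unfolding derivation_def by blast

text \<open>Theoremhood and derivability refer to each other: theorems may be cited in derivations,
  and derivations from no premise or (by R4) from a single premise yield theorems.
  This is the least solution.\<close>

inductive irl_theorem :: "'k fm \<Rightarrow> bool" where
  Ax: "irl_axiom y \<Longrightarrow> irl_theorem y"
| Der: "derivation irl_theorem {} ys y \<Longrightarrow> irl_theorem y"
| R4: "derivation irl_theorem {\<phi>} ys \<psi> \<Longrightarrow> irl_theorem (\<phi> \<^bold>\<rightarrow> \<psi>)"

definition derives :: "'k fm set \<Rightarrow> 'k fm \<Rightarrow> bool"  (infix "\<turnstile>" 50) where
  "X \<turnstile> y \<longleftrightarrow> (\<exists>ys. derivation irl_theorem X ys y)"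

lemma irl_theorem_iff_derives: "irl_theorem y \<longleftrightarrow> {} \<turnstile> y"
proof
  assume "irl_theorem y"
  then have "derivation irl_theorem {} [y] y" by (simp add: derivation_def)
  then show "{} \<turnstile> y" unfolding derives_def ..
qed (auto simp: derives_def intro: irl_theorem.Der)

lemma conditional_proof: "{\<phi>} \<turnstile> \<psi> \<Longrightarrow> {} \<turnstile> \<phi> \<^bold>\<rightarrow> \<psi>"
  by (metis derives_def irl_theorem.R4 irl_theorem_iff_derives)

end

theory Submission
  imports Defs
begin

text \<open>The argument is Boolean rewriting. Conjoin the premises to \<not>\<phi> \<and> (\<phi>
  \<or> \<psi>) and distribute; the disjunct \<not>\<phi> \<and> \<phi> becomes \<bottom> and is
  absorbed, leaving \<not>\<phi> \<and> \<psi>, from which \<psi> is extracted. To reason this way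
  without handling sequences, \<open>derives_R1\<close>, \<open>derives_R2\<close> and
  \<open>derives_R3\<close> make \<open>\<turnstile>\<close> closed under the primitive rules.
  \<open>derives_axiom_mp\<close> and \<open>derives_axiom_dis_left\<close> then rewrite with an
  axiom, at the root or in the left disjunct.\<close>

lemma infers_mono: "infers P y \<Longrightarrow> P \<subseteq> Q \<Longrightarrow> infers Q y"
  by (induction rule: infers.induct) (blast intro: infers.intros)+

text \<open>A line of \<open>zs\<close> keeps its justification behind \<open>ys\<close>, since
  having more earlier lines only enlarges the set from which it may be inferred.\<close>

lemma derivation_append:
  assumes "derivation T X ys a" "derivation T X zs b"
  shows "derivation T X (ys @ zs) b"
proof -
  have "T ((ys @ zs) ! i) \<or> infers (X \<union> set (take i (ys @ zs))) ((ys @ zs) ! i)"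
    if "i < length (ys @ zs)" for i
  proof (cases "i < length ys")
    case True
    with assms(1) show ?thesis
      by (simp add: derivation_def nth_append)
  next
    case False
    with that assms(2)
    have "T (zs ! (i - length ys)) \<or>
        infers (X \<union> set (take (i - length ys) zs)) (zs ! (i - length ys))"
      by (simp add: derivation_def)
    moreover have "X \<union> set (take (i - length ys) zs) \<subseteq> X \<union> set (take i (ys @ zs))"
      by auto
    ultimately show ?thesis
      using False by (auto simp: nth_append simp del: take_append dest: infers_mono)
  qed
  with assms show ?thesis
    by (simp add: derivation_def)
qed

lemma derivation_snoc:
  assumes "derivation T X ys a" "infers (X \<union> set ys) y"
  shows "derivation T X (ys @ [y]) y"
  using assms unfolding derivation_def by (auto simp: nth_append less_Suc_eq)

lemma derives_theorem: "irl_theorem y \<Longrightarrow> X \<turnstile> y"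
  unfolding derives_def derivation_def by (rule exI[of _ "[y]"]) simp

text \<open>Two formulas suffice because no rule consumes more; R2 is covered by taking
  \<open>a = b\<close>. Each is the last line of its derivation, so both occur in the
  concatenation.\<close>

lemma derives_infers:
  assumes "X \<turnstile> a" "X \<turnstile> b" "infers (insert a (insert b X)) y"
  shows "X \<turnstile> y"
proof -
  from assms obtain ys zs where d: "derivation irl_theorem X ys a" "derivation irl_theorem X zs b"
    unfolding derives_def by blast
  then have "a \<in> set ys" "b \<in> set zs"
    unfolding derivation_def by auto
  then have "infers (X \<union> set (ys @ zs)) y"
    by (intro infers_mono[OF assms(3)]) auto
  with derivation_append[OF d] show ?thesis
    unfolding derives_def by (blast intro: derivation_snoc)
qed

lemma derives_R1: "X \<turnstile> a \<Longrightarrow> X \<turnstile> b \<Longrightarrow> X \<turnstile> a \<^bold>\<and> b"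
  by (erule derives_infers) (auto intro: infers.R1)

lemma derives_R2: "X \<turnstile> a \<^bold>\<and> b \<Longrightarrow> X \<turnstile> a"
  by (rule derives_infers[of X "a \<^bold>\<and> b" "a \<^bold>\<and> b"]) (auto intro: infers.R2)

lemma derives_R3:
  assumes "X \<turnstile> a \<^bold>\<leftrightarrow> b" "X \<turnstile> c" "replacement a b c c'"
  shows "X \<turnstile> c'"
  using assms by (blast intro: derives_infers infers.R3)

text \<open>A premise is not itself a line, so it is duplicated by R1 and recovered by R2.\<close>

lemma derives_premise:
  assumes "a \<in> X"
  shows "X \<turnstile> a"
proof -
  have "derivation irl_theorem X [a \<^bold>\<and> a] (a \<^bold>\<and> a)"
    using assms by (auto simp: derivation_def intro: infers.R1)
  then have "X \<turnstile> a \<^bold>\<and> a"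
    unfolding derives_def by blast
  then show ?thesis
    by (rule derives_R2)
qed

lemma fill_map_Some: "fill a (map_fm Some c) = c"
  by (induction c) auto

text \<open>The template is a bare hole, which makes R3 act as modus ponens for
  \<leftrightarrow>.\<close>

lemma replacement_refl: "replacement a b a b"
  unfolding replacement_def by (rule exI[of _ "Atom None"]) simp

text \<open>Embedding \<open>c\<close> by \<open>map_fm Some\<close> creates no hole, so occurrences
  of \<open>a\<close> inside \<open>c\<close> stay untouched.\<close>

lemma replacement_dis_left: "replacement a b (a \<^bold>\<or> c) (b \<^bold>\<or> c)"
  unfolding replacement_def
  by (rule exI[of _ "Atom None \<^bold>\<or> map_fm Some c"]) (simp add: fill_map_Some)

lemma derives_axiom_mp: "irl_axiom (a \<^bold>\<leftrightarrow> b) \<Longrightarrow> X \<turnstile> a \<Longrightarrow> X \<turnstile> b"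
  by (blast intro: derives_R3 derives_theorem irl_theorem.Ax replacement_refl)

lemma derives_axiom_dis_left:
  "irl_axiom (a \<^bold>\<leftrightarrow> b) \<Longrightarrow> X \<turnstile> a \<^bold>\<or> c \<Longrightarrow> X \<turnstile> b \<^bold>\<or> c"
  by (blast intro: derives_R3 derives_theorem irl_theorem.Ax replacement_dis_left)

theorem mainTheorem8:
  fixes \<phi> \<psi> :: "'k::countable fm"
  shows "{\<phi> \<^bold>\<or> \<psi>, \<^bold>\<not> \<phi>} \<turnstile> \<psi>"
proof -
  let ?X = "{\<phi> \<^bold>\<or> \<psi>, \<^bold>\<not> \<phi>}"
  \<comment> \<open>The negation goes first because the axiom distributes a left conjunct.\<close>
  have "?X \<turnstile> \<^bold>\<not> \<phi> \<^bold>\<and> (\<phi> \<^bold>\<or> \<psi>)"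
    by (intro derives_R1 derives_premise) auto
  then have "?X \<turnstile> (\<^bold>\<not> \<phi> \<^bold>\<and> \<phi>) \<^bold>\<or> (\<^bold>\<not> \<phi> \<^bold>\<and> \<psi>)"
    by (rule derives_axiom_mp[OF con_dis_distrib])
  then have "?X \<turnstile> (\<phi> \<^bold>\<and> \<^bold>\<not> \<phi>) \<^bold>\<or> (\<^bold>\<not> \<phi> \<^bold>\<and> \<psi>)"
    by (rule derives_axiom_dis_left[OF con_comm])
  then have "?X \<turnstile> \<^bold>\<bottom> \<^bold>\<or> (\<^bold>\<not> \<phi> \<^bold>\<and> \<psi>)"
    by (rule derives_axiom_dis_left[OF con_neg])
  \<comment> \<open>\<open>dis_bot\<close> removes \<bottom> only on the right.\<close>
  then have "?X \<turnstile> (\<^bold>\<not> \<phi> \<^bold>\<and> \<psi>) \<^bold>\<or> \<^bold>\<bottom>"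
    by (rule derives_axiom_mp[OF dis_comm])
  then have "?X \<turnstile> \<^bold>\<not> \<phi> \<^bold>\<and> \<psi>"
    by (rule derives_axiom_mp[OF dis_bot])
  \<comment> \<open>R2 yields only the left conjunct.\<close>
  then have "?X \<turnstile> \<psi> \<^bold>\<and> \<^bold>\<not> \<phi>"
    by (rule derives_axiom_mp[OF con_comm])
  then show ?thesis
    by (rule derives_R2)
qed

end
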